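(* Let $n\ge1$ and $M>0$. Consider the class of all functions $$F(z):=\int_0^z\prod_{i=1}^n\left(f_i'(t)\right)^{\gamma_i}\,dt\qquad(z\in\Delta),$$ where $f_i\in\mathcal{K}$ $(1\le i\le n)$ and $\gamma_1,\ldots,\gamma_n\in\mathbb{C}$ satisfy $\sum_{i=1}^n|\gamma_i|\le M$. Then the radius of convexity of this class of integral operators is $$r_c'=\frac{1}{2M+1}.$$
   Context: $\Delta=\{z\in\mathbb{C}:|z|<1\}$. $\mathcal{A}$ is the set of functions $f$ analytic in $\Delta$ with $f(z)=z+a_2z^2+\cdots$. $\mathcal{K}$ is the class of convex functions: those $f\in\mathcal{A}$ with $\mathrm{Re}\left(1+\frac{zf''(z)}{f'(z)}\right)>0$ for $z\in\Delta$ (so in particular $f'\ne0$ in $\Delta$). The powers $(f_i')^{\gamma_i}$ are the analytic branches equal to $1$ at the origin. The radius of convexity of a class of such functions $F$ is the largest number $r\in(0,1)$ for which $\min_{|z|=r}\mathrm{Re}\left\{1+\frac{zF''(z)}{F'(z)}\right\}\ge 0$ for every $F$ in the class. *)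

theory Defs
  imports "HOL-Complex_Analysis.Complex_Analysis"
begin

definition normalized_analytic :: "(complex \<Rightarrow> complex) set" where
  "normalized_analytic = {f. f analytic_on ball 0 1 \<and> f 0 = 0 \<and> deriv f 0 = 1}"

definition convexity_quotient :: "(complex \<Rightarrow> complex) \<Rightarrow> complex \<Rightarrow> complex" where
  "convexity_quotient f z = 1 + z * deriv (deriv f) z / deriv f z"

(* The condition on the quotient presupposes that f' has no zero; since x / 0 = 0
   this has to be said explicitly. *)
definition convex_functions :: "(complex \<Rightarrow> complex) set" where
  "convex_functions = {f \<in> normalized_analytic.
     \<forall>z\<in>ball 0 1. deriv f z \<noteq> 0 \<and> Re (convexity_quotient f z) > 0}"

(* h is, on the unit disc, the analytic branch of g^c with value 1 at the origin:
   h = exp (c * L) for an analytic branch L of log g.  Different L with h 0 = 1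
   give the same h on the disc; values outside the disc are irrelevant. *)
definition is_power_branch ::
    "(complex \<Rightarrow> complex) \<Rightarrow> complex \<Rightarrow> (complex \<Rightarrow> complex) \<Rightarrow> bool" where
  "is_power_branch g c h \<longleftrightarrow>
     (\<exists>L. L analytic_on ball 0 1 \<and>
          (\<forall>z\<in>ball 0 1. exp (L z) = g z \<and> h z = exp (c * L z))) \<and>
     h 0 = 1"

(* The integrand is analytic in the disc, so the integral from 0 to z does not
   depend on the path; it is taken along the segment. *)
definition integral_operator_class :: "nat \<Rightarrow> real \<Rightarrow> (complex \<Rightarrow> complex) set" where
  "integral_operator_class n M = {F.
     \<exists>(f :: nat \<Rightarrow> complex \<Rightarrow> complex) (\<gamma> :: nat \<Rightarrow> complex) (h :: nat \<Rightarrow> complex \<Rightarrow> complex).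
       (\<forall>i\<in>{1..n}. f i \<in> convex_functions) \<and>
       (\<Sum>i=1..n. cmod (\<gamma> i)) \<le> M \<and>
       (\<forall>i\<in>{1..n}. is_power_branch (deriv (f i)) (\<gamma> i) (h i)) \<and>
       (\<forall>z\<in>ball 0 1. F z = contour_integral (linepath 0 z) (\<lambda>t. \<Prod>i=1..n. h i t))}"

definition is_minimum_on :: "('a \<Rightarrow> real) \<Rightarrow> 'a set \<Rightarrow> real \<Rightarrow> bool" where
  "is_minimum_on q S m \<longleftrightarrow> m \<in> q ` S \<and> (\<forall>x\<in>S. m \<le> q x)"

(* Intended for classes of analytic functions on the unit disc whose derivatives
   have no zero there, so that the quotient is genuine and the minimum exists. *)
definition convex_on_circle :: "(complex \<Rightarrow> complex) set \<Rightarrow> real \<Rightarrow> bool" where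
  "convex_on_circle \<F> r \<longleftrightarrow>
     (\<forall>F\<in>\<F>. \<exists>m\<ge>0. is_minimum_on (\<lambda>z. Re (convexity_quotient F z)) (sphere 0 r) m)"

definition is_radius_of_convexity :: "(complex \<Rightarrow> complex) set \<Rightarrow> real \<Rightarrow> bool" where
  "is_radius_of_convexity \<F> r \<longleftrightarrow>
     r \<in> {0<..<1} \<and> convex_on_circle \<F> r \<and>
     (\<forall>s\<in>{0<..<1}. convex_on_circle \<F> s \<longrightarrow> s \<le> r)"

end

theory Submission
  imports Defs
begin

text \<open>
  Logarithmic differentiation gives \<open>z F'' / F' = \<Sum>\<^sub>i \<gamma>\<^sub>i z f\<^sub>i'' / f\<^sub>i'\<close>. For convex \<open>f\<close> the function
  \<open>p = 1 + z f'' / f'\<close> has positive real part and \<open>p 0 = 1\<close>, so the Schwarz lemma for the Cayley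
  transform \<open>(p - 1) / (p + 1)\<close> yields \<open>\<bar>p z - 1\<bar> \<le> 2r / (1 - r)\<close> on \<open>\<bar>z\<bar> = r\<close>. Hence
  \<open>Re (1 + z F'' / F') \<ge> 1 - 2Mr / (1 - r)\<close>, which is nonnegative iff \<open>r \<le> 1 / (2M + 1)\<close>.
  Equality holds at \<open>z = r\<close> for \<open>f = z / (1 - z)\<close> and the exponents \<open>- M, 0, \<dots>, 0\<close>.
\<close>

section \<open>Logarithmic differentiation of the integral operator\<close>

text \<open>A holomorphic \<open>H\<close> has a primitive \<open>G\<close> on the convex set
  \<open>S\<close>. Segments from \<open>a\<close> stay in \<open>S\<close>, so \<open>F\<close>
  agrees there with \<open>G w - G a\<close>.\<close>

lemma contour_integral_linepath_has_field_derivative: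
  assumes H: "H holomorphic_on S" and S: "convex S" "open S" and a: "a \<in> S" and z: "z \<in> S"
    and F: "\<And>w. w \<in> S \<Longrightarrow> F w = contour_integral (linepath a w) H"
  shows "(F has_field_derivative H z) (at z)"
proof -
  obtain G where G: "\<And>w. w \<in> S \<Longrightarrow> (G has_field_derivative H w) (at w within S)"
    using holomorphic_convex_primitive'[OF S H] by blast
  have FG: "G w - G a = F w" if w: "w \<in> S" for w
  proof -
    have "path_image (linepath a w) \<subseteq> S"
      using a w S(1) by (simp add: closed_segment_subset)
    with contour_integral_primitive[of S G H "linepath a w", OF G]
    have "(H has_contour_integral (G w - G a)) (linepath a w)"
      by simp
    then show ?thesis
      using F[OF w] by (simp add: contour_integral_unique)
  qed
  have "((\<lambda>w. G w - G a) has_field_derivative H z) (at z)"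
    using G[OF z] at_within_open[OF z S(2)] by (auto intro!: derivative_eq_intros)
  then show ?thesis
    by (rule has_field_derivative_transform_within_open[OF _ S(2) z]) (use FG in auto)
qed

text \<open>Differentiating \<open>exp (L w) = g w\<close> gives
  \<open>deriv L z = deriv g z / g z\<close>, so the chosen logarithm \<open>L\<close> drops out of
  the formula.\<close>

lemma is_power_branch_has_field_derivative:
  assumes h: "is_power_branch g c h" and z: "z \<in> ball 0 1"
  shows "(h has_field_derivative c * (deriv g z / g z) * h z) (at z)"
proof -
  obtain L where L: "L analytic_on ball 0 1"
    and g: "\<And>w. w \<in> ball 0 1 \<Longrightarrow> exp (L w) = g w"
    and hL: "\<And>w. w \<in> ball 0 1 \<Longrightarrow> exp (c * L w) = h w"
    using h unfolding is_power_branch_def by force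
  have dL: "(L has_field_derivative deriv L z) (at z)"
    using L z analytic_on_imp_differentiable_at DERIV_deriv_iff_field_differentiable by blast
  have "((\<lambda>w. exp (L w)) has_field_derivative deriv L z * g z) (at z)"
    using dL g[OF z] by (auto intro!: derivative_eq_intros)
  then have "(g has_field_derivative deriv L z * g z) (at z)"
    by (rule has_field_derivative_transform_within_open[OF _ open_ball z g])
  then have dg: "deriv L z = deriv g z / g z"
    using g[OF z] by (auto dest!: DERIV_imp_deriv)
  have "((\<lambda>w. exp (c * L w)) has_field_derivative c * (deriv g z / g z) * h z) (at z)"
    using dL hL[OF z] unfolding dg by (auto intro!: derivative_eq_intros)
  then show ?thesis
    by (rule has_field_derivative_transform_within_open[OF _ open_ball z hL])
qed

lemma is_power_branch_nonzero:
  assumes "is_power_branch g c h" "z \<in> ball 0 1"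
  shows "h z \<noteq> 0"
  using assms unfolding is_power_branch_def by fastforce

text \<open>Writing each derivative as \<open>q i * h i z\<close> instead of dividing by
  \<open>h i z\<close> lets the induction run without nonvanishing assumptions.\<close>

lemma has_field_derivative_prod_logarithmic:
  assumes "finite A"
    and "\<And>i. i \<in> A \<Longrightarrow> (h i has_field_derivative q i * h i z) (at z)"
  shows "((\<lambda>w. \<Prod>i\<in>A. h i w) has_field_derivative (\<Sum>i\<in>A. q i) * (\<Prod>i\<in>A. h i z)) (at z)"
  using assms
  by (induction A rule: finite_induct) (auto intro!: derivative_eq_intros simp: algebra_simps)

text \<open>The data \<open>f\<close>, \<open>\<gamma>\<close>, \<open>h\<close> stay explicit so
  that the formula serves both the estimate for the whole class and the extremal example.\<close>

lemma convexity_quotient_integral: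
  fixes f h :: "nat \<Rightarrow> complex \<Rightarrow> complex"
  assumes h: "\<And>i. i \<in> {1..n} \<Longrightarrow> is_power_branch (deriv (f i)) (\<gamma> i) (h i)"
    and F: "\<And>w. w \<in> ball 0 1 \<Longrightarrow> F w = contour_integral (linepath 0 w) (\<lambda>t. \<Prod>i=1..n. h i t)"
    and z: "z \<in> ball 0 1"
  shows "convexity_quotient F z = 1 + (\<Sum>i=1..n. \<gamma> i * (convexity_quotient (f i) z - 1))"
proof -
  define H where "H = (\<lambda>t. \<Prod>i=1..n. h i t)"
  define S where "S = (\<lambda>w. \<Sum>i=1..n. \<gamma> i * (deriv (deriv (f i)) w / deriv (f i) w))"
  have dH: "(H has_field_derivative S w * H w) (at w)" if "w \<in> ball 0 1" for w
    unfolding H_def S_def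
    by (rule has_field_derivative_prod_logarithmic)
       (use that h is_power_branch_has_field_derivative in auto)
  have "H holomorphic_on ball 0 1"
    using dH holomorphic_on_open[OF open_ball] by blast
  then have dF: "deriv F w = H w" if "w \<in> ball 0 1" for w
    by (intro DERIV_imp_deriv contour_integral_linepath_has_field_derivative[of H "ball 0 1" 0])
       (use that F in \<open>auto simp: H_def\<close>)
  \<comment> \<open>The identity \<open>deriv F w = H w\<close> holds on the open disc, hence near
    \<open>z\<close>, and may therefore be differentiated once more.\<close>
  have "(deriv F has_field_derivative S z * H z) (at z)"
    by (rule has_field_derivative_transform_within_open[OF dH[OF z] open_ball z]) (simp add: dF)
  then have ddF: "deriv (deriv F) z = S z * H z"
    by (rule DERIV_imp_deriv)
  have "H z \<noteq> 0"
    unfolding H_def using is_power_branch_nonzero[OF h z] by simp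
  then have "convexity_quotient F z = 1 + z * S z"
    by (simp add: convexity_quotient_def dF[OF z] ddF)
  then show ?thesis
    by (simp add: convexity_quotient_def S_def sum_distrib_left mult_ac)
qed

section \<open>Sharp estimate for functions with positive real part\<close>

lemma caratheodory_bound:
  assumes p: "p holomorphic_on ball 0 1" "p 0 = 1"
    and pos: "\<And>z. z \<in> ball 0 1 \<Longrightarrow> Re (p z) > 0"
    and z: "z \<in> ball 0 1"
  shows "cmod (p z - 1) \<le> 2 * cmod z / (1 - cmod z)"
proof -
  define w where "w = (\<lambda>z. (p z - 1) / (p z + 1))"
  have nz: "p u + 1 \<noteq> 0" if "u \<in> ball 0 1" for u
    using pos[OF that] by (auto simp: complex_eq_iff)
  have "cmod (w u) < 1" if "cmod u < 1" for u
  proof -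
    have u: "u \<in> ball 0 1" using that by simp
    \<comment> \<open>The two squares differ by \<open>4 * Re (p u)\<close>.\<close>
    have "(cmod (p u - 1))\<^sup>2 < (cmod (p u + 1))\<^sup>2"
      using pos[OF u] unfolding cmod_power2 by (simp add: power2_eq_square algebra_simps)
    then have "cmod (p u - 1) < cmod (p u + 1)"
      by (rule power2_less_imp_less) simp
    then show ?thesis
      using nz[OF u] by (simp add: w_def norm_divide divide_simps)
  qed
  moreover have "w holomorphic_on ball 0 1"
    unfolding w_def using p(1) nz by (intro holomorphic_intros) auto
  moreover have "w 0 = 0"
    using p(2) by (simp add: w_def)
  ultimately have le: "cmod (w z) \<le> cmod z"
    using Schwarz_Lemma(1)[of w z] z by simp
  have z1: "cmod z < 1" using z by simp
  \<comment> \<open>This inverts the Cayley transform, \<open>p - 1 = 2 w / (1 - w)\<close>, with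
    the denominator cleared.\<close>
  have "(p z - 1) * (1 - w z) = 2 * w z"
    using nz[OF z] by (simp add: w_def field_simps)
  then have "cmod (p z - 1) * cmod (1 - w z) = 2 * cmod (w z)"
    by (metis norm_mult norm_numeral)
  moreover have "1 - cmod z \<le> cmod (1 - w z)"
    using norm_triangle_ineq2[of 1 "w z"] le by simp
  ultimately have "cmod (p z - 1) * (1 - cmod z) \<le> 2 * cmod z"
    using le mult_left_mono[of "1 - cmod z" "cmod (1 - w z)" "cmod (p z - 1)"] by simp
  then show ?thesis
    using z1 by (simp add: pos_le_divide_eq)
qed

lemma convexity_quotient_holomorphic:
  assumes "f \<in> convex_functions"
  shows "convexity_quotient f holomorphic_on ball 0 1"
proof -
  have hol: "f holomorphic_on ball 0 1"
    using assms by (simp add: convex_functions_def normalized_analytic_def analytic_imp_holomorphic)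
  then have "deriv f holomorphic_on ball 0 1" "deriv (deriv f) holomorphic_on ball 0 1"
    by (simp_all add: holomorphic_deriv)
  then show ?thesis
    unfolding convexity_quotient_def[abs_def] using assms
    by (intro holomorphic_intros) (auto simp: convex_functions_def hol)
qed

lemma convexity_quotient_bound:
  assumes f: "f \<in> convex_functions" and z: "z \<in> ball 0 1"
  shows "cmod (convexity_quotient f z - 1) \<le> 2 * cmod z / (1 - cmod z)"
  by (rule caratheodory_bound[OF convexity_quotient_holomorphic[OF f] _ _ z])
     (use f in \<open>auto simp: convex_functions_def convexity_quotient_def\<close>)

section \<open>Convexity on circles up to the critical radius\<close>

lemma integral_operator_class_convex_on_circle:
  assumes M: "M > 0" and r: "0 < r" "r \<le> 1 / (2 * M + 1)"
  shows "convex_on_circle (integral_operator_class n M) r"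
  unfolding convex_on_circle_def
proof
  fix F assume "F \<in> integral_operator_class n M"
  then obtain f \<gamma> h where f: "\<And>i. i \<in> {1..n} \<Longrightarrow> f i \<in> convex_functions"
    and \<gamma>: "(\<Sum>i=1..n. cmod (\<gamma> i)) \<le> M"
    and h: "\<And>i. i \<in> {1..n} \<Longrightarrow> is_power_branch (deriv (f i)) (\<gamma> i) (h i)"
    and F: "\<And>z. z \<in> ball 0 1 \<Longrightarrow> F z = contour_integral (linepath 0 z) (\<lambda>t. \<Prod>i=1..n. h i t)"
    unfolding integral_operator_class_def by blast
  have rM: "r * (2 * M + 1) \<le> 1"
    using r M by (simp add: field_simps)
  have "r * 1 < r * (2 * M + 1)"
    using r M by (intro mult_strict_left_mono) auto
  then have r1: "r < 1" using rM by simp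
  have sphere: "sphere 0 r \<subseteq> ball (0::complex) 1"
    using r1 by auto
  \<comment> \<open>The minimum in \<open>is_minimum_on\<close> must be attained. The closed form
    \<open>Q\<close> is holomorphic on the disc, so compactness of the circle provides a minimizer
    \<open>x\<close>, and only \<open>Re (Q x)\<close> has to be estimated.\<close>
  define Q where "Q = (\<lambda>z. 1 + (\<Sum>i=1..n. \<gamma> i * (convexity_quotient (f i) z - 1)))"
  have Q: "convexity_quotient F z = Q z" if "z \<in> ball 0 1" for z
    unfolding Q_def using convexity_quotient_integral[OF h F that] .
  have "Q holomorphic_on ball 0 1"
    unfolding Q_def using f convexity_quotient_holomorphic by (intro holomorphic_intros) auto
  then have cont: "continuous_on (sphere 0 r) (\<lambda>z. Re (Q z))"
    using sphere
    by (intro continuous_on_Re holomorphic_on_imp_continuous_on) (rule holomorphic_on_subset)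
  have "sphere (0::complex) r \<noteq> {}"
    using r(1) by simp
  then obtain x where x: "x \<in> sphere 0 r" "\<forall>y\<in>sphere 0 r. Re (Q x) \<le> Re (Q y)"
    using continuous_attains_inf[OF compact_sphere _ cont] by blast
  have "cmod (Q x - 1) \<le> (\<Sum>i=1..n. cmod (\<gamma> i) * (2 * r / (1 - r)))"
    unfolding Q_def add_diff_cancel_left'
  proof (rule sum_norm_le)
    fix i assume "i \<in> {1..n}"
    then have "cmod (convexity_quotient (f i) x - 1) \<le> 2 * r / (1 - r)"
      using convexity_quotient_bound[OF f, of i x] x(1) sphere by auto
    then show "cmod (\<gamma> i * (convexity_quotient (f i) x - 1)) \<le> cmod (\<gamma> i) * (2 * r / (1 - r))"
      by (simp add: norm_mult mult_left_mono del: times_divide_eq_right)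
  qed
  also have "\<dots> = (\<Sum>i=1..n. cmod (\<gamma> i)) * (2 * r / (1 - r))"
    by (rule sum_distrib_right[symmetric])
  also have "\<dots> \<le> M * (2 * r / (1 - r))"
    using \<gamma> r(1) r1 by (intro mult_right_mono) auto
  also have "\<dots> \<le> 1"
    using rM r1 by (simp add: field_simps)
  finally have "Re (Q x) \<ge> 0"
    using abs_Re_le_cmod[of "Q x - 1"] by simp
  moreover have "is_minimum_on (\<lambda>z. Re (convexity_quotient F z)) (sphere 0 r) (Re (Q x))"
    unfolding is_minimum_on_def using x Q sphere by (auto simp: subset_iff intro!: image_eqI[of _ _ x])
  ultimately show "\<exists>m\<ge>0. is_minimum_on (\<lambda>z. Re (convexity_quotient F z)) (sphere 0 r) m"
    by blast
qed

section \<open>The extremal function and sharpness\<close>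

text \<open>This maps the disc onto the half plane \<open>Re w > - 1 / 2\<close> and gives equality
  in \<open>convexity_quotient_bound\<close> at each point of \<open>[0, 1)\<close>.\<close>

definition half_plane_map :: "complex \<Rightarrow> complex" where
  "half_plane_map z = z / (1 - z)"

lemma deriv_half_plane_map:
  assumes "z \<noteq> 1"
  shows "deriv half_plane_map z = 1 / (1 - z)\<^sup>2"
  unfolding half_plane_map_def[abs_def] using assms
  by (auto intro!: DERIV_imp_deriv derivative_eq_intros simp: divide_simps power2_eq_square)

lemma deriv_deriv_half_plane_map:
  assumes "z \<noteq> 1"
  shows "deriv (deriv half_plane_map) z = 2 / (1 - z) ^ 3"
proof -
  have "((\<lambda>z. 1 / (1 - z)\<^sup>2) has_field_derivative 2 / (1 - z) ^ 3) (at z)"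
    using assms
    by (auto intro!: derivative_eq_intros simp: divide_simps power2_eq_square power3_eq_cube)
  then have "(deriv half_plane_map has_field_derivative 2 / (1 - z) ^ 3) (at z)"
    by (rule has_field_derivative_transform_within_open[where S = "- {1}"])
       (use assms in \<open>auto simp: deriv_half_plane_map\<close>)
  then show ?thesis
    by (rule DERIV_imp_deriv)
qed

lemma convexity_quotient_half_plane_map:
  assumes "z \<noteq> 1"
  shows "convexity_quotient half_plane_map z = (1 + z) / (1 - z)"
  using assms
  by (simp add: convexity_quotient_def deriv_half_plane_map deriv_deriv_half_plane_map
      divide_simps power2_eq_square power3_eq_cube)

lemma half_plane_map_convex: "half_plane_map \<in> convex_functions"
proof -
  have "Re ((1 + z) / (1 - z)) > 0" if z: "cmod z < 1" for z
  proof -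
    have "(cmod z)\<^sup>2 < 1"
      using z by (simp add: power_less_one_iff abs_square_less_1)
    \<comment> \<open>This real part equals \<open>1 - (cmod z)\<^sup>2\<close>; dividing by the
      square of \<open>cmod (1 - z)\<close> preserves its sign.\<close>
    then have "Re ((1 + z) * cnj (1 - z)) > 0"
      unfolding cmod_power2 by (simp add: power2_eq_square algebra_simps)
    moreover have "1 - z \<noteq> 0"
      using z by auto
    ultimately show ?thesis
      by (subst complex_div_cnj) (simp add: Re_divide_of_real del: Re_divide)
  qed
  moreover have "half_plane_map analytic_on ball 0 1"
    unfolding half_plane_map_def[abs_def] by (intro analytic_intros) auto
  moreover have "z \<noteq> 1" if "cmod z < 1" for z
    using that by auto
  ultimately show ?thesis
    by (auto simp: convex_functions_def normalized_analytic_def half_plane_map_def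
        deriv_half_plane_map convexity_quotient_half_plane_map)
qed

text \<open>On the disc \<open>1 - z\<close> has positive real part, so the principal
  \<open>Ln\<close> is analytic there and \<open>- 2 * Ln (1 - z)\<close> is a logarithm of
  \<open>1 / (1 - z)\<^sup>2\<close>.\<close>

lemma is_power_branch_deriv_half_plane_map:
  "is_power_branch (deriv half_plane_map) c (\<lambda>z. exp (c * (- 2 * Ln (1 - z))))"
proof -
  have nonpos: "1 - z \<notin> \<real>\<^sub>\<le>\<^sub>0" if "cmod z < 1" for z :: complex
    using that complex_Re_le_cmod[of z] by (auto simp: complex_nonpos_Reals_iff)
  have "(\<lambda>z. - 2 * Ln (1 - z)) analytic_on ball 0 1"
    using nonpos by (intro analytic_intros) auto
  moreover have "exp (- 2 * Ln (1 - z)) = deriv half_plane_map z" if "cmod z < 1" for z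
  proof -
    have "z \<noteq> 1" using that by auto
    have "exp (- 2 * Ln (1 - z)) = inverse (exp (Ln (1 - z)) ^ 2)"
      by (simp add: exp_minus flip: exp_double)
    also have "\<dots> = deriv half_plane_map z"
      using \<open>z \<noteq> 1\<close> by (simp add: deriv_half_plane_map divide_inverse)
    finally show ?thesis .
  qed
  ultimately show ?thesis
    unfolding is_power_branch_def by (auto intro!: exI[of _ "\<lambda>z. - 2 * Ln (1 - z)"])
qed

lemma convex_on_circle_integral_operator_class_le:
  assumes n: "n \<ge> 1" and M: "M > 0" and s: "s \<in> {0<..<1}"
    and convex: "convex_on_circle (integral_operator_class n M) s"
  shows "s \<le> 1 / (2 * M + 1)"
proof -
  \<comment> \<open>The whole budget \<open>M\<close> goes to index 1, which exists as
    \<open>n \<ge> 1\<close>; the other factors become 1. The negative sign makes the quotient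
    decrease along the positive real axis.\<close>
  define \<gamma> :: "nat \<Rightarrow> complex" where "\<gamma> = (\<lambda>i. if i = 1 then - of_real M else 0)"
  define h where "h = (\<lambda>i z. exp (\<gamma> i * (- 2 * Ln (1 - z))))"
  define F where "F = (\<lambda>z. contour_integral (linepath 0 z) (\<lambda>t. \<Prod>i=1..n. h i t))"
  have h: "is_power_branch (deriv half_plane_map) (\<gamma> i) (h i)" for i
    unfolding h_def by (rule is_power_branch_deriv_half_plane_map)
  have "(\<Sum>i=1..n. cmod (\<gamma> i)) = (\<Sum>i=1..n. if i = 1 then M else 0)"
    using M by (intro sum.cong) (auto simp: \<gamma>_def)
  then have "(\<Sum>i=1..n. cmod (\<gamma> i)) \<le> M"
    using n M by (simp add: sum.delta')
  then have "F \<in> integral_operator_class n M"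
    unfolding integral_operator_class_def F_def using h half_plane_map_convex
    by (intro CollectI exI[of _ "\<lambda>_. half_plane_map"] exI[of _ \<gamma>] exI[of _ h]) auto
  moreover have "of_real s \<in> sphere (0::complex) s"
    using s by simp
  \<comment> \<open>A nonnegative minimum bounds the value at every point of the circle, in
    particular at the extremal point \<open>s\<close>.\<close>
  ultimately have ge: "0 \<le> Re (convexity_quotient F (of_real s))"
    using convex unfolding convex_on_circle_def is_minimum_on_def by (meson order_trans)
  have s1: "of_real s \<noteq> (1::complex)" "of_real s \<in> ball (0::complex) 1"
    using s by auto
  have "convexity_quotient F (of_real s)
      = 1 + (\<Sum>i=1..n. \<gamma> i * (convexity_quotient half_plane_map (of_real s) - 1))"
    using convexity_quotient_integral[of n "\<lambda>_. half_plane_map" \<gamma> h F] h s1(2)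
    by (simp add: F_def)
  also have "\<dots> = 1 + (\<Sum>i=1..n. \<gamma> i) * (convexity_quotient half_plane_map (of_real s) - 1)"
    by (simp add: sum_distrib_right)
  also have "(\<Sum>i=1..n. \<gamma> i) = - of_real M"
    unfolding \<gamma>_def using n by (simp add: sum.delta')
  also have "convexity_quotient half_plane_map (of_real s) - 1 = of_real (2 * s / (1 - s))"
    using s1(1) by (simp add: convexity_quotient_half_plane_map field_simps)
  also have "1 + - of_real M * of_real (2 * s / (1 - s)) = complex_of_real (1 - M * (2 * s / (1 - s)))"
    by simp
  finally have "0 \<le> 1 - M * (2 * s / (1 - s))"
    using ge by (metis Re_complex_of_real)
  \<comment> \<open>Multiplying by \<open>1 - s > 0\<close> turns the inequality into
    \<open>s * (2 * M + 1) \<le> 1\<close>.\<close>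
  then show ?thesis
    using s M by (simp add: field_simps)
qed

theorem corollary2p1:
  fixes n :: nat and M :: real
  assumes "n \<ge> 1" and "M > 0"
  shows "is_radius_of_convexity (integral_operator_class n M) (1 / (2 * M + 1))"
  unfolding is_radius_of_convexity_def
proof (intro conjI ballI impI)
  show "1 / (2 * M + 1) \<in> {0<..<1}"
    using assms(2) by simp
  show "convex_on_circle (integral_operator_class n M) (1 / (2 * M + 1))"
    using assms(2) by (intro integral_operator_class_convex_on_circle) auto
qed (use assms convex_on_circle_integral_operator_class_le in blast)

end
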